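(* For all integers $L\geq 1$ and $n\geq 0$, $$ \sum_{m\geq 0}\binom{m}{2}a_2(L,m,n)\ \geq\ \sum_{m\geq 0}\binom{m}{2}b_2(2L,m,n). $$
   Context: The hook length of a cell in the Young diagram of a partition is one plus the number of cells to its right in the same row plus the number of cells below it in the same column. A hook of length two means a cell whose hook length equals $2$. For integers $L\ge 1$ and $m,n\ge 0$: $a_2(L,m,n)$ is the number of partitions of $n$ into odd parts (repetitions allowed), each at most $2L-1$, having exactly $m$ hooks of length two; $b_2(L,m,n)$ is the number of partitions of $n$ into distinct parts, each at most $L$, having exactly $m$ hooks of length two. Thus $b_2(2L,m,n)$ concerns distinct parts at most $2L$. *)

theory Defs
  imports Complex_Main
begin

text \<open>A partition of \<open>n\<close> is the weakly decreasing list of its (positive) parts.\<close>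

definition is_partition :: "nat \<Rightarrow> nat list \<Rightarrow> bool" where
  "is_partition n p \<longleftrightarrow> sorted_wrt (\<ge>) p \<and> 0 \<notin> set p \<and> sum_list p = n"

text \<open>Rows and columns are numbered from 0; row \<open>i\<close> lies above row \<open>i + 1\<close>.\<close>

definition cells :: "nat list \<Rightarrow> (nat \<times> nat) set" where
  "cells p = {(i, j). i < length p \<and> j < p ! i}"

definition hook_length :: "nat list \<Rightarrow> nat \<times> nat \<Rightarrow> nat" where
  "hook_length p = (\<lambda>(i, j).
     1 + card {j'. j < j' \<and> (i, j') \<in> cells p} + card {i'. i < i' \<and> (i', j) \<in> cells p})"

definition num_hooks :: "nat \<Rightarrow> nat list \<Rightarrow> nat" where
  "num_hooks k p = card {c \<in> cells p. hook_length p c = k}"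

definition a2 :: "nat \<Rightarrow> nat \<Rightarrow> nat \<Rightarrow> nat" where
  "a2 L m n = card {p. is_partition n p \<and> (\<forall>x\<in>set p. odd x \<and> x \<le> 2 * L - 1) \<and>
     num_hooks 2 p = m}"

definition b2 :: "nat \<Rightarrow> nat \<Rightarrow> nat \<Rightarrow> nat" where
  "b2 L m n = card {p. is_partition n p \<and> distinct p \<and> (\<forall>x\<in>set p. x \<le> L) \<and>
     num_hooks 2 p = m}"

text \<open>All counted sets are finite, and for fixed \<open>L\<close> and \<open>n\<close> only finitely many \<open>m\<close>
  contribute, so that series over \<open>m\<close> are genuine finite sums.\<close>

lemma finite_partitions: "finite {p. is_partition n p}"
proof (rule finite_subset)
  have *: "length p \<le> sum_list p" if "0 \<notin> set p" for p :: "nat list"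
    using that by (induction p) (auto simp: Suc_le_eq)
  show "{p. is_partition n p} \<subseteq> {p. set p \<subseteq> {..n} \<and> length p \<le> n}"
    using * by (auto simp: is_partition_def member_le_sum_list)
qed (simp add: finite_lists_length_le)

lemma finite_cells: "finite (cells p)"
proof -
  have "cells p = (SIGMA i:{..<length p}. {..<p ! i})"
    by (auto simp: cells_def)
  then show ?thesis by simp
qed

lemma finite_support:
  "finite {m. a2 L m n \<noteq> 0}" "finite {m. b2 L m n \<noteq> 0}"
proof -
  have fin: "finite (num_hooks 2 ` {p. is_partition n p})"
    by (simp add: finite_partitions)
  show "finite {m. a2 L m n \<noteq> 0}" "finite {m. b2 L m n \<noteq> 0}"
    by (rule finite_subset[OF _ fin]; auto simp: a2_def b2_def card_eq_0_iff)+
qed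

lemma summable_binomial_moments:
  "summable (\<lambda>m. (m choose k) * a2 L m n)" "summable (\<lambda>m. (m choose k) * b2 L m n)"
  by (rule summable_finite[OF finite_support(1)[of L n]], simp)
     (rule summable_finite[OF finite_support(2)[of L n]], simp)

end

theory Submission
  imports Defs "HOL-Library.Multiset" "HOL-Computational_Algebra.Formal_Power_Series"
begin

text \<open>In a partition, the hooks of length two correspond to the parts \<open>s \<ge> 2\<close> such that \<open>s - 1\<close>
  is not a part, and to the part sizes of multiplicity at least two.
  For distinct parts at most \<open>N\<close>, a recursion on \<open>N\<close> evaluates the second binomial moment as
  \<open>q\<^sup>6 (1 - q^(N-3)) (1 - q^(N-2)) / ((1 - q\<^sup>2) (1 - q\<^sup>4)) \<Prod>i\<le>N-2. (1 + q^i)\<close>.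
  For \<open>N = 2 L\<close> this is coefficientwise at most
  \<open>(\<Sum>s\<le>t. q^(s+t)) \<Prod>i\<le>2L-2. (1 + q^i)\<close>, where \<open>s, t\<close> range over the odd numbers from \<open>3\<close> to
  \<open>2 L - 1\<close>. By Glaisher's theorem the product is dominated by the generating function of the
  partitions into odd parts at most \<open>2 L - 1\<close>. The resulting series counts these partitions with a
  marked pair of parts \<open>s \<le> t\<close>, and such a pair determines two hooks of length two.\<close>

subsection \<open>Hooks of length two\<close>

text \<open>Hooks extend only to the right and downwards, so a new top row leaves the old hook
  lengths unchanged. In the new row, cell \<open>j\<close> has arm \<open>x - j - 1\<close>, and its
  leg counts the rows of \<open>p\<close> longer than \<open>j\<close>.\<close>

lemma num_hooks_Cons:
  "num_hooks k (x # p) =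
     card {j. j < x \<and> x - j + length (filter (\<lambda>y. j < y) p) = k} + num_hooks k p"
proof -
  have cells: "cells (x # p) = Pair 0 ` {..<x} \<union> map_prod Suc id ` cells p"
    by (auto simp: cells_def image_iff nth_Cons map_prod_def split: nat.splits)
  have first: "hook_length (x # p) (0, j) = x - j + length (filter (\<lambda>y. j < y) p)"
    if "j < x" for j
  proof -
    have arm: "{j'. j < j' \<and> (0, j') \<in> cells (x # p)} = {j<..<x}"
      by (auto simp: cells_def)
    have leg: "{i'. 0 < i' \<and> (i', j) \<in> cells (x # p)} = Suc ` {i. i < length p \<and> j < p ! i}"
      by (auto simp: cells_def image_iff nth_Cons split: nat.splits) (use gr0_conv_Suc in blast)
    show ?thesis
      using that unfolding hook_length_def by (simp add: arm leg card_image length_filter_conv_card)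
  qed
  have rest: "hook_length (x # p) (Suc i, j) = hook_length p (i, j)" for i j
  proof -
    have arm: "{j'. j < j' \<and> (Suc i, j') \<in> cells (x # p)} = {j'. j < j' \<and> (i, j') \<in> cells p}"
      by (auto simp: cells_def)
    have leg: "{i'. Suc i < i' \<and> (i', j) \<in> cells (x # p)}
        = Suc ` {i'. i < i' \<and> (i', j) \<in> cells p}"
      by (auto simp: cells_def image_iff nth_Cons split: nat.splits) (metis gr0_conv_Suc)
    show ?thesis
      unfolding hook_length_def by (simp add: arm leg card_image)
  qed
  have "{c \<in> cells (x # p). hook_length (x # p) c = k} =
      Pair 0 ` {j. j < x \<and> x - j + length (filter (\<lambda>y. j < y) p) = k} \<union>
      map_prod Suc id ` {c \<in> cells p. hook_length p c = k}" (is "_ = ?A \<union> ?B")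
    unfolding cells using first rest by (fastforce simp: map_prod_def)
  moreover have "card (?A \<union> ?B) = card ?A + card ?B"
    by (intro card_Un_disjoint) (auto simp: finite_cells)
  moreover have "card ?A = card {j. j < x \<and> x - j + length (filter (\<lambda>y. j < y) p) = k}"
    by (intro card_image inj_onI) auto
  moreover have "card ?B = num_hooks k p"
    unfolding num_hooks_def by (intro card_image inj_onI) (auto simp: map_prod_def)
  ultimately show ?thesis
    unfolding num_hooks_def by simp
qed

text \<open>\<open>run_starts\<close> accounts for the hooks with arm 1 and leg 0, \<open>repeated\<close> for those with arm 0
  and leg 1.\<close>

definition run_starts :: "nat set \<Rightarrow> nat set" where
  "run_starts S = {s \<in> S. 2 \<le> s \<and> s - 1 \<notin> S}"

definition repeated :: "nat multiset \<Rightarrow> nat set" where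
  "repeated M = {s. 2 \<le> count M s}"

lemma finite_run_starts: "finite S \<Longrightarrow> finite (run_starts S)"
  by (simp add: run_starts_def)

lemma finite_repeated: "finite (repeated M)"
proof (rule finite_subset)
  show "repeated M \<subseteq> set_mset M"
  proof
    fix s assume "s \<in> repeated M"
    then have "2 \<le> count M s"
      by (simp only: repeated_def mem_Collect_eq)
    then have "0 < count M s"
      by linarith
    then show "s \<in># M"
      by (simp only: count_greater_zero_iff)
  qed
qed simp

text \<open>Only the last two cells of the row can have hook length 2. The last one has arm 0 and
  needs exactly one further row of length \<open>x\<close>; its left neighbour has arm 1 and needs
  an empty leg, that is, no row of length \<open>x - 1\<close> or \<open>x\<close> below.\<close>

lemma card_first_row_two_hooks:
  assumes "\<forall>y\<in>set p. y \<le> x" "0 < x"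
  shows "card {j. j < x \<and> x - j + length (filter (\<lambda>y. j < y) p) = 2} =
    of_bool (2 \<le> x \<and> x - 1 \<notin> set p \<and> x \<notin> set p) + of_bool (count (mset p) x = 1)"
proof -
  have count: "length (filter (\<lambda>y. x - Suc 0 < y) p) = count (mset p) x"
  proof -
    have "filter (\<lambda>y. x - Suc 0 < y) p = filter ((=) x) p"
      using assms by (intro filter_cong) force+
    then show ?thesis
      by (simp add: count_mset count_list_eq_length_filter)
  qed
  have empty: "filter (\<lambda>y. x - 2 < y) p = [] \<longleftrightarrow> x - 1 \<notin> set p \<and> x \<notin> set p" if "2 \<le> x"
  proof -
    have "x - 2 < y \<longleftrightarrow> y = x - 1 \<or> y = x" if "y \<in> set p" for y
      using assms that \<open>2 \<le> x\<close> by fastforce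
    then show ?thesis
      by (auto simp: filter_empty_conv)
  qed
  have "{j. j < x \<and> x - j + length (filter (\<lambda>y. j < y) p) = 2} =
     (if 2 \<le> x \<and> x - 1 \<notin> set p \<and> x \<notin> set p then {x - 2} else {}) \<union>
     (if count (mset p) x = 1 then {x - 1} else {})" (is "?S = ?T")
  proof (rule set_eqI)
    fix j
    consider "j = x - 1" | "j = x - 2" "2 \<le> x" | "j + 2 < x" | "x \<le> j"
      by linarith
    then show "j \<in> ?S \<longleftrightarrow> j \<in> ?T"
    proof cases
      case 1
      then show ?thesis using assms count by auto
    next
      case 2
      then show ?thesis using empty by auto
    qed (use assms in auto)
  qed
  then show ?thesis
    using assms by (auto simp: card_insert_if)
qed

text \<open>The induction removes the largest part \<open>x\<close>. The two indicators of the first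
  row say that \<open>x\<close> starts a new run and that its multiplicity rises from 1 to 2, so
  each repeated size is counted once.\<close>

lemma num_hooks_two:
  assumes "sorted_wrt (\<ge>) p" "0 \<notin> set p"
  shows "num_hooks 2 p = card (run_starts (set p)) + card (repeated (mset p))"
  using assms
proof (induction p)
  case Nil
  then show ?case by (simp add: num_hooks_def cells_def run_starts_def repeated_def)
next
  case (Cons x p)
  have le: "\<forall>y\<in>set p. y \<le> x" and x: "0 < x"
    using Cons.prems by auto
  have "run_starts (insert x (set p)) =
      (if 2 \<le> x \<and> x - 1 \<notin> set p \<and> x \<notin> set p then insert x (run_starts (set p))
       else run_starts (set p))"
  proof (cases "x \<in> set p")
    case False
    \<comment> \<open>As \<open>x\<close> is the largest part, inserting it cannot stop another
      \<open>s\<close> from starting a run.\<close>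
    moreover have "s - 1 \<noteq> x" if "s \<in> set p" "s \<ge> 2" for s
      using le that by fastforce
    ultimately show ?thesis
      by (auto simp: run_starts_def)
  qed (simp add: insert_absorb)
  moreover have "x \<notin> run_starts (set p)" if "x \<notin> set p"
    using that by (simp add: run_starts_def)
  ultimately have starts: "card (run_starts (insert x (set p))) = card (run_starts (set p)) +
      of_bool (2 \<le> x \<and> x - 1 \<notin> set p \<and> x \<notin> set p)"
    by (simp add: finite_run_starts)
  have "repeated (add_mset x (mset p)) =
      (if count (mset p) x = 1 then insert x (repeated (mset p)) else repeated (mset p))"
    by (auto simp: repeated_def simp del: count_greater_zero_iff set_mset_mset count_greater_eq_one_iff
        simp flip: count_greater_zero_iff set_mset_mset)
  moreover have x_notin: "x \<notin> repeated (mset p)" if "count (mset p) x = 1"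
    using that by (simp add: repeated_def)
  ultimately have rep: "card (repeated (add_mset x (mset p))) = card (repeated (mset p)) +
      of_bool (count (mset p) x = 1)"
    using finite_repeated x_notin by simp
  show ?case
    using Cons card_first_row_two_hooks[OF le x] by (simp add: num_hooks_Cons starts rep)
qed

section \<open>Binomial moments as sums over multisets and sets of parts\<close>

lemma suminf_card_fibres:
  fixes f :: "nat \<Rightarrow> nat"
  assumes "finite A"
  shows "(\<Sum>m. f m * card {p \<in> A. g p = m}) = (\<Sum>p\<in>A. f (g p))"
proof -
  have "(\<Sum>m. f m * card {p \<in> A. g p = m}) = (\<Sum>m\<in>g ` A. f m * card {p \<in> A. g p = m})"
    using assms by (intro suminf_finite) (auto simp: card_eq_0_iff)
  also have "\<dots> = (\<Sum>m\<in>g ` A. \<Sum>p\<in>{p \<in> A. g p = m}. f (g p))"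
    by (simp add: mult.commute)
  also have "\<dots> = (\<Sum>p\<in>A. f (g p))"
    using assms by (intro sum.group) auto
  finally show ?thesis .
qed

lemma bij_betw_mset_partitions:
  "bij_betw mset {p. is_partition n p \<and> Q (mset p)} {M. 0 \<notin># M \<and> \<Sum>\<^sub># M = n \<and> Q M}"
proof (rule bij_betwI[where g = "\<lambda>M. rev (sorted_list_of_multiset M)"])
  show "mset \<in> {p. is_partition n p \<and> Q (mset p)} \<rightarrow> {M. 0 \<notin># M \<and> \<Sum>\<^sub># M = n \<and> Q M}"
    by (auto simp: is_partition_def sum_mset_sum_list)
  show "(\<lambda>M. rev (sorted_list_of_multiset M)) \<in>
      {M. 0 \<notin># M \<and> \<Sum>\<^sub># M = n \<and> Q M} \<rightarrow> {p. is_partition n p \<and> Q (mset p)}"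
    by (auto simp: is_partition_def sorted_wrt_rev simp flip: sum_mset_sum_list)
  show "rev (sorted_list_of_multiset (mset p)) = p" if "p \<in> {p. is_partition n p \<and> Q (mset p)}" for p
  proof -
    have "sorted (rev p)"
      using that by (simp add: is_partition_def sorted_wrt_rev)
    then have "sort (rev p) = rev p"
      by (rule sorted_sort_id)
    then show ?thesis
      by (metis mset_rev rev_rev_ident sorted_list_of_multiset_mset)
  qed
qed simp

text \<open>With multisets, removing prescribed parts is a subtraction; the recursions for
  generating functions rest on this.\<close>

definition multiset_partitions :: "nat set \<Rightarrow> nat \<Rightarrow> nat multiset set" where
  "multiset_partitions T n = {M. set_mset M \<subseteq> T \<and> \<Sum>\<^sub># M = n}"

lemma finite_multiset_partitions:
  assumes "0 \<notin> T"
  shows "finite (multiset_partitions T n)"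
proof -
  have "finite (mset ` {p. is_partition n p \<and> True})"
    by (simp add: finite_partitions)
  also have "mset ` {p. is_partition n p \<and> True} = {M. 0 \<notin># M \<and> \<Sum>\<^sub># M = n \<and> True}"
    by (rule bij_betw_imp_surj_on[OF bij_betw_mset_partitions[where Q = "\<lambda>_. True"]])
  finally show ?thesis
    by (rule rev_finite_subset) (use assms in \<open>auto simp: multiset_partitions_def\<close>)
qed

abbreviation odd_parts :: "nat \<Rightarrow> nat set" where
  "odd_parts L \<equiv> {s. odd s \<and> s \<le> 2 * L - 1}"

lemma suminf_a2:
  "(\<Sum>m. (m choose 2) * a2 L m n) = (\<Sum>M\<in>multiset_partitions (odd_parts L) n.
     (card (run_starts (set_mset M)) + card (repeated M)) choose 2)"
proof -
  let ?A = "{p. is_partition n p \<and> set_mset (mset p) \<subseteq> odd_parts L}"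
  have "(\<Sum>m. (m choose 2) * a2 L m n) = (\<Sum>m. (m choose 2) * card {p \<in> ?A. num_hooks 2 p = m})"
    unfolding a2_def by (intro suminf_cong arg_cong2[of _ _ _ _ "(*)"] arg_cong[of _ _ card] refl) auto
  also have "\<dots> = (\<Sum>p\<in>?A. num_hooks 2 p choose 2)"
    by (intro suminf_card_fibres) (simp add: finite_partitions)
  also have "\<dots> = (\<Sum>p\<in>?A. (card (run_starts (set_mset (mset p))) + card (repeated (mset p))) choose 2)"
    by (intro sum.cong refl) (simp add: num_hooks_two is_partition_def)
  also have "\<dots> = (\<Sum>M\<in>{M. 0 \<notin># M \<and> \<Sum>\<^sub># M = n \<and> set_mset M \<subseteq> odd_parts L}.
     (card (run_starts (set_mset M)) + card (repeated M)) choose 2)"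
    by (rule sum.reindex_bij_betw[OF bij_betw_mset_partitions])
  also have "{M. 0 \<notin># M \<and> \<Sum>\<^sub># M = n \<and> set_mset M \<subseteq> odd_parts L}
      = multiset_partitions (odd_parts L) n"
    by (auto simp: multiset_partitions_def)
  finally show ?thesis .
qed

lemma bij_betw_set_distinct_partitions:
  "bij_betw set {p. is_partition n p \<and> distinct p \<and> (\<forall>x\<in>set p. x \<le> N)}
     {S. S \<subseteq> {1..N} \<and> \<Sum>S = n}"
proof (rule bij_betwI[where g = "\<lambda>S. rev (sorted_list_of_set S)"])
  show "set \<in> {p. is_partition n p \<and> distinct p \<and> (\<forall>x\<in>set p. x \<le> N)}
      \<rightarrow> {S. S \<subseteq> {1..N} \<and> \<Sum>S = n}"
    by (auto simp: is_partition_def distinct_sum_list_conv_Sum Suc_le_eq intro!: gr0I)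
  show "(\<lambda>S. rev (sorted_list_of_set S)) \<in> {S. S \<subseteq> {1..N} \<and> \<Sum>S = n}
      \<rightarrow> {p. is_partition n p \<and> distinct p \<and> (\<forall>x\<in>set p. x \<le> N)}"
    by (fastforce simp: is_partition_def sorted_wrt_rev distinct_sum_list_conv_Sum finite_subset)
  show "rev (sorted_list_of_set (set p)) = p"
    if "p \<in> {p. is_partition n p \<and> distinct p \<and> (\<forall>x\<in>set p. x \<le> N)}" for p
  proof -
    have "sorted (rev p)" "distinct (rev p)"
      using that by (simp_all add: is_partition_def sorted_wrt_rev)
    then have "sorted_list_of_set (set (rev p)) = rev p"
      by (simp only: sorted_list_of_set.idem_if_sorted_distinct)
    then show ?thesis
      by simp
  qed
qed (auto simp: finite_subset)

text \<open>Distinct parts leave no repeated sizes, so only run starts contribute.\<close>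

lemma suminf_b2:
  "(\<Sum>m. (m choose 2) * b2 N m n) =
     (\<Sum>S\<in>{S. S \<subseteq> {1..N} \<and> \<Sum>S = n}. card (run_starts S) choose 2)"
proof -
  let ?A = "{p. is_partition n p \<and> distinct p \<and> (\<forall>x\<in>set p. x \<le> N)}"
  have "(\<Sum>m. (m choose 2) * b2 N m n) = (\<Sum>m. (m choose 2) * card {p \<in> ?A. num_hooks 2 p = m})"
    unfolding b2_def by (intro suminf_cong arg_cong2[of _ _ _ _ "(*)"] arg_cong[of _ _ card] refl) auto
  also have "\<dots> = (\<Sum>p\<in>?A. num_hooks 2 p choose 2)"
    by (intro suminf_card_fibres) (simp add: finite_partitions)
  also have "\<dots> = (\<Sum>p\<in>?A. card (run_starts (set p)) choose 2)"
  proof (intro sum.cong refl)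
    fix p assume p: "p \<in> ?A"
    then have "repeated (mset p) = {}"
      by (auto simp: repeated_def distinct_count_atmost_1)
    with p show "num_hooks 2 p choose 2 = card (run_starts (set p)) choose 2"
      by (simp add: num_hooks_two is_partition_def)
  qed
  also have "\<dots> = (\<Sum>S\<in>{S. S \<subseteq> {1..N} \<and> \<Sum>S = n}. card (run_starts S) choose 2)"
    by (rule sum.reindex_bij_betw[OF bij_betw_set_distinct_partitions])
  finally show ?thesis .
qed

subsection \<open>Distinct parts and odd parts\<close>

text \<open>Coefficientwise \<open>f \<le> g\<close> is stated as \<open>nonneg_fps (g - f)\<close>;
  closure under products lets such inequalities be multiplied by nonnegative series.\<close>

definition nonneg_fps :: "int fps \<Rightarrow> bool" where
  "nonneg_fps f \<longleftrightarrow> (\<forall>n. 0 \<le> fps_nth f n)"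

lemma nonneg_fps_add: "nonneg_fps f \<Longrightarrow> nonneg_fps g \<Longrightarrow> nonneg_fps (f + g)"
  by (simp add: nonneg_fps_def)

lemma nonneg_fps_mult: "nonneg_fps f \<Longrightarrow> nonneg_fps g \<Longrightarrow> nonneg_fps (f * g)"
  by (simp add: nonneg_fps_def fps_mult_nth sum_nonneg)

lemma nonneg_fps_1: "nonneg_fps 1"
  by (simp add: nonneg_fps_def)

lemma nonneg_fps_X_power: "nonneg_fps (fps_X ^ k)"
  by (simp add: nonneg_fps_def fps_X_power_nth)

lemma nonneg_fps_sum: "(\<And>x. x \<in> A \<Longrightarrow> nonneg_fps (f x)) \<Longrightarrow> nonneg_fps (sum f A)"
  by (simp add: nonneg_fps_def fps_sum_nth sum_nonneg)

lemma nonneg_fps_prod: "(\<And>x. x \<in> A \<Longrightarrow> nonneg_fps (f x)) \<Longrightarrow> nonneg_fps (prod f A)"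
  by (induction A rule: infinite_finite_induct) (auto intro: nonneg_fps_mult nonneg_fps_1)

lemmas nonneg_fps_intros = nonneg_fps_add nonneg_fps_mult nonneg_fps_1 nonneg_fps_X_power
  nonneg_fps_sum nonneg_fps_prod

definition distinct_gf :: "nat \<Rightarrow> int fps" where
  "distinct_gf N = (\<Prod>i=1..N. 1 + fps_X ^ i)"

section \<open>Odd parts of numbers and binary expansions\<close>

fun odd_part :: "nat \<Rightarrow> nat" where
  "odd_part n = (if even n \<and> 0 < n then odd_part (n div 2) else n)"

declare odd_part.simps [simp del]

lemma odd_part_odd: "odd s \<Longrightarrow> odd_part (s * 2 ^ k) = s"
proof (induction k)
  case 0
  then show ?case by (simp add: odd_part.simps[of s])
next
  case (Suc k)
  moreover have "s * 2 ^ Suc k div 2 = s * 2 ^ k" "even (s * 2 ^ Suc k)"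
    by simp_all
  ultimately show ?case
    by (subst odd_part.simps) (simp add: odd_pos)
qed

lemma odd_part_decompose: "0 < n \<Longrightarrow> odd (odd_part n) \<and> (\<exists>k. n = odd_part n * 2 ^ k)"
proof (induction n rule: less_induct)
  case (less n)
  show ?case
  proof (cases "even n")
    case True
    then have "odd (odd_part (n div 2)) \<and> (\<exists>k. n div 2 = odd_part (n div 2) * 2 ^ k)"
      using less by (intro less.IH) auto
    moreover have "odd_part n = odd_part (n div 2)"
      using True less.prems by (simp add: odd_part.simps[of n])
    ultimately show ?thesis
      using True by (metis dvd_mult_div_cancel mult.left_commute power_Suc)
  next
    case False
    then have "odd_part n = n"
      by (simp add: odd_part.simps[of n])
    then show ?thesis
      using False by (auto intro: exI[of _ 0])
  qed
qed

text \<open>Every \<open>j < 2 ^ K\<close> has a unique binary expansion; in the induction the new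
  factor appends a copy of the sum shifted by \<open>2 ^ K\<close>.\<close>

lemma prod_one_plus_power_two_powers:
  fixes z :: "'a :: comm_semiring_1"
  shows "(\<Prod>k<K. 1 + z ^ 2 ^ k) = (\<Sum>j<2 ^ K. z ^ j)"
proof (induction K)
  case (Suc K)
  have "(\<Sum>j<2 ^ Suc K. z ^ j) = (\<Sum>j<2 ^ K. z ^ j) + (\<Sum>j=2 ^ K..<2 ^ K + 2 ^ K. z ^ j)"
    by (simp add: mult_2 lessThan_atLeast0 sum.atLeastLessThan_concat)
  also have "(\<Sum>j=2 ^ K..<2 ^ K + 2 ^ K. z ^ j) = (\<Sum>j<2 ^ K. z ^ (j + 2 ^ K))"
    using sum.shift_bounds_nat_ivl[of "\<lambda>j. z ^ j" 0 "2 ^ K" "2 ^ K"] by (simp add: lessThan_atLeast0)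
  finally show ?case
    using Suc by (simp add: power_add sum_distrib_left sum.distrib algebra_simps)
qed simp

text \<open>The numbers up to \<open>N\<close> with odd part \<open>s\<close> are the
  \<open>s * 2 ^ k\<close> with \<open>k < K\<close>, so binary expansion with
  \<open>z = fps_X ^ s\<close> gives the sum with \<open>c = 2 ^ K\<close>.\<close>

lemma prod_odd_part_fibre:
  assumes "odd s"
  shows "\<exists>c. (\<Prod>i\<in>{i \<in> {1..N}. odd_part i = s}. 1 + fps_X ^ i :: int fps) = (\<Sum>j<c. fps_X ^ (s * j))"
proof -
  \<comment> \<open>For \<open>s > N\<close> this gives \<open>K = 0\<close>: the fibre is empty and
    both sides are 1.\<close>
  define K where "K = (LEAST k. N < s * 2 ^ k)"
  have s: "0 < s"
    using assms by (rule odd_pos)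
  \<comment> \<open>The exponent \<open>N\<close> shows that the least \<open>k\<close>
    exists.\<close>
  have "N < 2 ^ N" by simp
  also have "\<dots> \<le> s * 2 ^ N" using s by simp
  finally have K: "N < s * 2 ^ K"
    unfolding K_def by (rule LeastI)
  have iff: "s * 2 ^ k \<le> N \<longleftrightarrow> k < K" for k
  proof
    assume "s * 2 ^ k \<le> N"
    with K have "s * 2 ^ k < s * 2 ^ K" by linarith
    then show "k < K" by simp
  next
    assume "k < K"
    then show "s * 2 ^ k \<le> N"
      unfolding K_def using not_less_Least not_le by blast
  qed
  have "{i \<in> {1..N}. odd_part i = s} = (\<lambda>k. s * 2 ^ k) ` {..<K}"
  proof (intro equalityI subsetI)
    fix i assume i: "i \<in> {i \<in> {1..N}. odd_part i = s}"
    then obtain k where "i = s * 2 ^ k"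
      using odd_part_decompose[of i] by auto
    with i iff show "i \<in> (\<lambda>k. s * 2 ^ k) ` {..<K}" by auto
  next
    fix i assume "i \<in> (\<lambda>k. s * 2 ^ k) ` {..<K}"
    then show "i \<in> {i \<in> {1..N}. odd_part i = s}"
      using iff s odd_part_odd[OF assms] by (auto simp: Suc_le_eq)
  qed
  moreover have "inj_on (\<lambda>k. s * 2 ^ k) {..<K}"
    using s by (auto intro!: inj_onI)
  ultimately have "(\<Prod>i\<in>{i \<in> {1..N}. odd_part i = s}. 1 + fps_X ^ i :: int fps)
      = (\<Prod>k<K. 1 + (fps_X ^ s) ^ 2 ^ k)"
    by (simp add: prod.reindex power_mult)
  also have "\<dots> = (\<Sum>j<2 ^ K. fps_X ^ (s * j))"
    by (simp add: prod_one_plus_power_two_powers power_mult)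
  finally show ?thesis by blast
qed

section \<open>Generating functions of partitions with parts in a given set\<close>

lemma card_multiset_partitions_superset:
  assumes "set_mset A \<subseteq> T"
  shows "card {M \<in> multiset_partitions T n. A \<subseteq># M} =
    (if n < \<Sum>\<^sub># A then 0 else card (multiset_partitions T (n - \<Sum>\<^sub># A)))"
proof (cases "n < \<Sum>\<^sub># A")
  case True
  have "\<Sum>\<^sub># A \<le> \<Sum>\<^sub># M" if "A \<subseteq># M" for M
    using that by (metis le_add1 subset_mset.add_diff_inverse sum_mset.union)
  with True have "{M \<in> multiset_partitions T n. A \<subseteq># M} = {}"
    by (force simp: multiset_partitions_def)
  with True show ?thesis by (simp only: card.empty if_True)
next
  case False
  have "bij_betw ((+) A) (multiset_partitions T (n - \<Sum>\<^sub># A)) {M \<in> multiset_partitions T n. A \<subseteq># M}"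
    by (rule bij_betwI[where g = "\<lambda>M. M - A"])
      (use False assms in \<open>auto simp: multiset_partitions_def sum_mset_diff dest: in_diffD\<close>)
  then have "card (multiset_partitions T (n - \<Sum>\<^sub># A)) = card {M \<in> multiset_partitions T n. A \<subseteq># M}"
    by (rule bij_betw_same_card)
  with False show ?thesis by simp
qed

definition partition_gf :: "nat set \<Rightarrow> int fps" where
  "partition_gf T = Abs_fps (\<lambda>n. int (card (multiset_partitions T n)))"

lemma nonneg_partition_gf: "nonneg_fps (partition_gf T)"
  by (simp add: nonneg_fps_def partition_gf_def)

lemma fps_nth_X_power_mult_partition_gf:
  assumes "set_mset A \<subseteq> T"
  shows "fps_nth (fps_X ^ \<Sum>\<^sub># A * partition_gf T) n =
    int (card {M \<in> multiset_partitions T n. A \<subseteq># M})"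
  using assms by (simp add: fps_X_power_mult_nth partition_gf_def card_multiset_partitions_superset)

text \<open>A partition either avoids \<open>s\<close> or loses one copy of it. This is the factor
  1/(1 - q^s) without division.\<close>

lemma partition_gf_insert:
  assumes "s \<notin> T" "0 \<notin> T" "0 < s"
  shows "partition_gf (insert s T) = partition_gf T + fps_X ^ s * partition_gf (insert s T)"
proof (rule fps_ext)
  fix n
  have "multiset_partitions (insert s T) n =
      multiset_partitions T n \<union> {M \<in> multiset_partitions (insert s T) n. {#s#} \<subseteq># M}"
    by (auto simp: multiset_partitions_def)
  moreover have "multiset_partitions T n \<inter>
      {M \<in> multiset_partitions (insert s T) n. {#s#} \<subseteq># M} = {}"
    using assms by (auto simp: multiset_partitions_def)
  moreover have "finite (multiset_partitions T n)" "finite (multiset_partitions (insert s T) n)"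
    using assms by (simp_all add: finite_multiset_partitions)
  ultimately have "card (multiset_partitions (insert s T) n) = card (multiset_partitions T n) +
      card {M \<in> multiset_partitions (insert s T) n. {#s#} \<subseteq># M}"
    by (metis (no_types, lifting) card_Un_disjoint finite_Un)
  then show "fps_nth (partition_gf (insert s T)) n =
      fps_nth (partition_gf T + fps_X ^ s * partition_gf (insert s T)) n"
    using fps_nth_X_power_mult_partition_gf[of "{#s#}" "insert s T" n]
    by (simp add: partition_gf_def)
qed

text \<open>Unrolling the recursion \<open>c\<close> times leaves as remainder the partitions with
  at least \<open>c\<close> copies of \<open>s\<close>.\<close>

lemma partition_gf_insert_ge:
  assumes "s \<notin> T" "0 \<notin> T" "0 < s"
  shows "nonneg_fps (partition_gf (insert s T) - (\<Sum>j<c. fps_X ^ (s * j)) * partition_gf T)"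
proof -
  have "partition_gf (insert s T) =
      (\<Sum>j<c. fps_X ^ (s * j)) * partition_gf T + fps_X ^ (s * c) * partition_gf (insert s T)"
  proof (induction c)
    case (Suc c)
    have "(\<Sum>j<Suc c. fps_X ^ (s * j)) * partition_gf T + fps_X ^ (s * Suc c) * partition_gf (insert s T)
        = (\<Sum>j<c. fps_X ^ (s * j)) * partition_gf T +
          fps_X ^ (s * c) * (partition_gf T + fps_X ^ s * partition_gf (insert s T))"
      by (simp add: algebra_simps power_add)
    also have "partition_gf T + fps_X ^ s * partition_gf (insert s T) = partition_gf (insert s T)"
      by (rule partition_gf_insert[OF assms, symmetric])
    finally have step: "(\<Sum>j<Suc c. fps_X ^ (s * j)) * partition_gf T +
        fps_X ^ (s * Suc c) * partition_gf (insert s T) =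
      (\<Sum>j<c. fps_X ^ (s * j)) * partition_gf T + fps_X ^ (s * c) * partition_gf (insert s T)" .
    show ?case
      unfolding step by (rule Suc)
  qed simp
  then have "partition_gf (insert s T) - (\<Sum>j<c. fps_X ^ (s * j)) * partition_gf T =
      fps_X ^ (s * c) * partition_gf (insert s T)"
    by (simp add: algebra_simps)
  then show ?thesis
    by (simp add: nonneg_fps_intros nonneg_partition_gf)
qed

text \<open>The product counts only those partitions in which each \<open>s\<close> occurs fewer
  than \<open>c s\<close> times.\<close>

lemma partition_gf_ge_prod:
  assumes "finite T" "0 \<notin> T"
  shows "nonneg_fps (partition_gf T - (\<Prod>s\<in>T. \<Sum>j<c s. fps_X ^ (s * j)))"
  using assms
proof (induction T rule: finite_induct)
  case empty
  have "partition_gf {} = 1"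
  proof (rule fps_ext)
    fix n
    have "multiset_partitions {} n = (if n = 0 then {{#}} else {})"
      by (auto simp: multiset_partitions_def)
    then show "fps_nth (partition_gf {}) n = fps_nth 1 n"
      by (simp add: partition_gf_def)
  qed
  then show ?case by (simp add: nonneg_fps_def)
next
  case (insert s T)
  let ?E = "\<Sum>j<c s. fps_X ^ (s * j) :: int fps"
  have "nonneg_fps ((partition_gf (insert s T) - ?E * partition_gf T) +
      ?E * (partition_gf T - (\<Prod>s\<in>T. \<Sum>j<c s. fps_X ^ (s * j))))"
    using insert by (intro nonneg_fps_intros partition_gf_insert_ge) auto
  with insert.hyps show ?case
    by (simp add: algebra_simps)
qed

text \<open>Glaisher's map: the parts of a distinct partition with odd part \<open>s\<close> are merged into
  copies of \<open>s\<close>.\<close>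

lemma distinct_gf_le_partition_gf:
  assumes "finite T" "\<forall>s\<in>T. odd s" "\<forall>s. odd s \<and> s \<le> N \<longrightarrow> s \<in> T"
  shows "nonneg_fps (partition_gf T - distinct_gf N)"
proof -
  have "\<forall>s\<in>T. \<exists>c. (\<Prod>i\<in>{i \<in> {1..N}. odd_part i = s}. 1 + fps_X ^ i :: int fps) = (\<Sum>j<c. fps_X ^ (s * j))"
    using assms prod_odd_part_fibre by blast
  then obtain c where c: "\<And>s. s \<in> T \<Longrightarrow>
      (\<Prod>i\<in>{i \<in> {1..N}. odd_part i = s}. 1 + fps_X ^ i :: int fps) = (\<Sum>j<c s. fps_X ^ (s * j))"
    by metis
  \<comment> \<open>The odd part of \<open>i\<close> is at most \<open>i\<close>, so it lies in
    \<open>T\<close> and the grouping by odd parts loses no factor.\<close>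
  have "odd_part i \<in> T" if "i \<in> {1..N}" for i
  proof -
    have "0 < i"
      using that by simp
    then obtain k where k: "odd (odd_part i)" "i = odd_part i * 2 ^ k"
      using odd_part_decompose by blast
    then have "odd_part i * 1 \<le> i"
      by (metis mult_le_mono2 one_le_numeral one_le_power)
    with k that assms show ?thesis by simp
  qed
  then have "distinct_gf N = (\<Prod>s\<in>T. \<Prod>i\<in>{i \<in> {1..N}. odd_part i = s}. 1 + fps_X ^ i)"
    unfolding distinct_gf_def using assms by (intro prod.group[symmetric]) auto
  also have "\<dots> = (\<Prod>s\<in>T. \<Sum>j<c s. fps_X ^ (s * j))"
    by (intro prod.cong refl c)
  finally show ?thesis
    using partition_gf_ge_prod[of T c] assms by fastforce
qed

subsection \<open>The second moment for distinct parts\<close>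

text \<open>Binomial weights are used because Pascal's rule turns them into a recursion on
  \<open>N\<close>.\<close>

definition distinct_moment :: "nat \<Rightarrow> nat \<Rightarrow> int fps" where
  "distinct_moment k N = (\<Sum>S\<in>Pow {1..N}. of_nat (card (run_starts S) choose k) * fps_X ^ \<Sum>S)"

lemma sum_Pow_atLeastAtMost_Suc:
  "(\<Sum>S\<in>Pow {1..Suc N}. g S) = (\<Sum>S\<in>Pow {1..N}. g S) + (\<Sum>S\<in>Pow {1..N}. g (insert (Suc N) S))"
proof -
  have "Pow {1..Suc N} = Pow {1..N} \<union> insert (Suc N) ` Pow {1..N}"
    by (simp add: atLeastAtMostSuc_conv Pow_insert)
  moreover have "Pow {1..N} \<inter> insert (Suc N) ` Pow {1..N} = {}"
    by auto
  moreover have "inj_on (insert (Suc N)) (Pow {1..N})"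
  proof (rule inj_onI)
    fix S S' assume "S \<in> Pow {1..N}" "S' \<in> Pow {1..N}" "insert (Suc N) S = insert (Suc N) S'"
    moreover from this have "Suc N \<notin> S" "Suc N \<notin> S'"
      by auto
    ultimately show "S = S'"
      by (simp add: insert_ident)
  qed
  ultimately show ?thesis
    by (simp add: sum.union_disjoint sum.reindex)
qed

lemma distinct_moment_0: "distinct_moment 0 N = distinct_gf N"
proof (induction N)
  case 0
  then show ?case by (simp add: distinct_moment_def distinct_gf_def)
next
  case (Suc N)
  have "(\<Sum>S\<in>Pow {1..N}. fps_X ^ \<Sum>(insert (Suc N) S)) =
      fps_X ^ Suc N * (\<Sum>S\<in>Pow {1..N}. fps_X ^ \<Sum>S :: int fps)"
    unfolding sum_distrib_left
  proof (intro sum.cong refl)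
    fix S assume "S \<in> Pow {1..N}"
    then have "finite S" "Suc N \<notin> S" by (auto intro: finite_subset)
    then show "fps_X ^ \<Sum>(insert (Suc N) S) = fps_X ^ Suc N * (fps_X ^ \<Sum>S :: int fps)"
      by (simp add: power_add)
  qed
  with Suc show ?case
    unfolding distinct_moment_def sum_Pow_atLeastAtMost_Suc
    by (simp add: distinct_gf_def algebra_simps)
qed

lemma distinct_moment_Suc_small: "distinct_moment (Suc k) 0 = 0" "distinct_moment (Suc k) (Suc 0) = 0"
proof -
  have "run_starts S = {}" if "S \<subseteq> {1..Suc 0}" for S
    using that by (force simp: run_starts_def)
  then show "distinct_moment (Suc k) 0 = 0" "distinct_moment (Suc k) (Suc 0) = 0"
    unfolding distinct_moment_def by (auto intro!: sum.neutral)
qed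

text \<open>A new maximum starts a run exactly when its predecessor is missing, and it affects no
  other start.\<close>

lemma card_run_starts_insert:
  assumes "S \<subseteq> {1..Suc N}"
  shows "card (run_starts (insert (Suc (Suc N)) S)) = card (run_starts S) + of_bool (Suc N \<notin> S)"
proof -
  have "Suc (Suc N) \<notin> S" "finite S"
    using assms by (auto intro: finite_subset)
  moreover have "s - 1 \<noteq> Suc (Suc N)" if "s \<in> S" for s
    using that assms by fastforce
  ultimately have "run_starts (insert (Suc (Suc N)) S) =
      (if Suc N \<notin> S then insert (Suc (Suc N)) (run_starts S) else run_starts S)"
    by (auto simp: run_starts_def)
  moreover have "Suc (Suc N) \<notin> run_starts S"
    using \<open>Suc (Suc N) \<notin> S\<close> by (simp add: run_starts_def)
  ultimately show ?thesis
    using \<open>finite S\<close> by (simp add: finite_run_starts)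
qed

text \<open>Split by membership of \<open>N + 2\<close>. If it is present and \<open>N + 1\<close>
  is not, Pascal's rule yields an extra term of order \<open>k\<close>, with the rest of the set
  ranging over subsets of \<open>{1..N}\<close>.\<close>

lemma distinct_moment_Suc_Suc:
  "distinct_moment (Suc k) (Suc (Suc N)) =
     (1 + fps_X ^ Suc (Suc N)) * distinct_moment (Suc k) (Suc N) +
     fps_X ^ Suc (Suc N) * distinct_moment k N"
proof -
  let ?w = "\<lambda>k S. of_nat (card (run_starts S) choose k) * fps_X ^ \<Sum>S :: int fps"
  have "?w (Suc k) (insert (Suc (Suc N)) S) =
      fps_X ^ Suc (Suc N) * (?w (Suc k) S + (if Suc N \<notin> S then ?w k S else 0))"
    if "S \<in> Pow {1..Suc N}" for S
  proof -
    have "Suc (Suc N) \<notin> S" "finite S"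
      using that by (auto intro: finite_subset)
    then have "\<Sum>(insert (Suc (Suc N)) S) = Suc (Suc N) + \<Sum>S"
      by simp
    then show ?thesis
      using that by (simp add: card_run_starts_insert power_add algebra_simps)
  qed
  then have "(\<Sum>S\<in>Pow {1..Suc N}. ?w (Suc k) (insert (Suc (Suc N)) S)) =
      (\<Sum>S\<in>Pow {1..Suc N}. fps_X ^ Suc (Suc N) * (?w (Suc k) S + (if Suc N \<notin> S then ?w k S else 0)))"
    by (rule sum.cong[OF refl])
  also have "\<dots> = fps_X ^ Suc (Suc N) *
      (distinct_moment (Suc k) (Suc N) + (\<Sum>S\<in>Pow {1..Suc N}. if Suc N \<notin> S then ?w k S else 0))"
    by (simp only: sum_distrib_left[symmetric] sum.distrib distinct_moment_def)
  also have "(\<Sum>S\<in>Pow {1..Suc N}. if Suc N \<notin> S then ?w k S else 0) =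
      sum (?w k) {S \<in> Pow {1..Suc N}. Suc N \<notin> S}"
    by (rule sum.inter_filter[symmetric]) simp
  also have "{S \<in> Pow {1..Suc N}. Suc N \<notin> S} = Pow {1..N}"
    by (auto simp: subset_iff le_Suc_eq)
  also have "sum (?w k) (Pow {1..N}) = distinct_moment k N"
    by (simp only: distinct_moment_def)
  also have "(\<Sum>S\<in>Pow {1..Suc N}. ?w (Suc k) (insert (Suc (Suc N)) S)) =
      distinct_moment (Suc k) (Suc (Suc N)) - distinct_moment (Suc k) (Suc N)"
    by (simp only: distinct_moment_def sum_Pow_atLeastAtMost_Suc[where N = "Suc N"] add_diff_cancel_left')
  finally show ?thesis
    by (simp add: algebra_simps)
qed

lemma distinct_gf_Suc: "distinct_gf (Suc N) = (1 + fps_X ^ Suc N) * distinct_gf N"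
  by (simp add: distinct_gf_def mult.commute)

lemma distinct_moment_1:
  "(1 - fps_X ^ 2) * distinct_moment 1 (Suc N) = fps_X ^ 2 * (1 - fps_X ^ N) * distinct_gf N"
proof (induction N)
  case 0
  then show ?case using distinct_moment_Suc_small[of 0] by simp
next
  case (Suc N)
  have "(1 - fps_X ^ 2) * distinct_moment 1 (Suc (Suc N)) =
      (1 + fps_X ^ Suc (Suc N)) * ((1 - fps_X ^ 2) * distinct_moment 1 (Suc N)) +
      fps_X ^ Suc (Suc N) * (1 - fps_X ^ 2) * distinct_gf N"
    using distinct_moment_Suc_Suc[of 0 N] by (simp add: distinct_moment_0 algebra_simps)
  \<comment> \<open>Apart from q^2 and \<open>distinct_gf N\<close>, the sum collapses to 1 -
    q^(2N+2), whose factor 1 + q^(N+1) extends the product.\<close>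
  also have "\<dots> = fps_X ^ 2 * (1 - fps_X ^ Suc N) * distinct_gf (Suc N)"
    unfolding Suc distinct_gf_Suc by (simp add: algebra_simps power2_eq_square)
  finally show ?case .
qed

text \<open>The lightest set with two run starts is {2, 4}, whence q^6; sets within {1, 2, 3} have
  at most one, matching the zero factor at \<open>N = 0\<close>.\<close>

lemma distinct_moment_2:
  "(1 - fps_X ^ 2) * (1 - fps_X ^ 4) * distinct_moment 2 (N + 3) =
     fps_X ^ 6 * (1 - fps_X ^ N) * (1 - fps_X ^ Suc N) * distinct_gf (Suc N)"
proof (induction N)
  case 0
  have "distinct_moment 2 2 = 0"
    using distinct_moment_Suc_Suc[of 1 0] distinct_moment_Suc_small
    by (simp add: numeral_2_eq_2)
  then have "distinct_moment 2 3 = 0"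
    using distinct_moment_Suc_Suc[of 1 1] distinct_moment_Suc_small[of 0]
    by (simp add: numeral_2_eq_2 numeral_3_eq_3)
  then show ?case by simp
next
  case (Suc N)
  have rec: "distinct_moment 2 (Suc N + 3) =
      (1 + fps_X ^ (N + 4)) * distinct_moment 2 (N + 3) + fps_X ^ (N + 4) * distinct_moment 1 (Suc (Suc N))"
    using distinct_moment_Suc_Suc[of 1 "N + 2"]
    by (simp add: numeral_eq_Suc)
  \<comment> \<open>Naming q^N as \<open>y\<close> makes the induction step a polynomial
    identity.\<close>
  define x y D :: "int fps" where "x = fps_X" and "y = fps_X ^ N" and "D = distinct_gf (Suc N)"
  have pow: "fps_X ^ Suc N = x * y" "fps_X ^ Suc (Suc N) = x\<^sup>2 * y" "fps_X ^ (N + 4) = x ^ 4 * y"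
    by (simp_all add: x_def y_def power_add power2_eq_square)
  have IH: "(1 - x ^ 2) * (1 - x ^ 4) * distinct_moment 2 (N + 3) = x ^ 6 * (1 - y) * (1 - x * y) * D"
    using Suc by (simp add: x_def y_def D_def)
  have one: "(1 - x ^ 2) * distinct_moment 1 (Suc (Suc N)) = x ^ 2 * (1 - x * y) * D"
    using distinct_moment_1[of "Suc N"] by (simp add: x_def y_def D_def)
  have "(1 - x ^ 2) * (1 - x ^ 4) * distinct_moment 2 (Suc N + 3) =
      (1 + x ^ 4 * y) * ((1 - x ^ 2) * (1 - x ^ 4) * distinct_moment 2 (N + 3)) +
      x ^ 4 * y * (1 - x ^ 4) * ((1 - x ^ 2) * distinct_moment 1 (Suc (Suc N)))"
    unfolding rec pow by algebra
  \<comment> \<open>Beside the common factor \<open>x ^ 6 * (1 - x * y) * D\<close> stands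
    \<open>1 - x ^ 4 * y ^ 2\<close>, which splits as a difference of squares.\<close>
  also have "\<dots> = x ^ 6 * (1 - x * y) * (1 - x\<^sup>2 * y) * ((1 + x\<^sup>2 * y) * D)"
    unfolding IH one by algebra
  finally show ?case
    using distinct_gf_Suc[of "Suc N"] unfolding D_def[symmetric] pow by (simp add: x_def)
qed

section \<open>Pairs of odd sizes and the comparison of both moments\<close>

definition pair_gf :: "nat \<Rightarrow> int fps" where
  "pair_gf M = (\<Sum>a\<le>M. \<Sum>b\<le>a. fps_X ^ (2 * a + 2 * b))"

lemma sum_even_powers: "(1 - fps_X ^ 2) * (\<Sum>b\<le>M. fps_X ^ (2 * b)) = (1 - fps_X ^ (2 * M + 2) :: int fps)"
proof (induction M)
  case (Suc M)
  have "(1 - fps_X ^ 2) * (\<Sum>b\<le>Suc M. fps_X ^ (2 * b)) =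
      (1 - fps_X ^ 2) * (\<Sum>b\<le>M. fps_X ^ (2 * b)) + (1 - fps_X ^ 2) * (fps_X ^ (2 * Suc M) :: int fps)"
    by (simp only: sum.atMost_Suc distrib_left)
  also have "\<dots> = 1 - fps_X ^ (2 * Suc M + 2)"
    unfolding Suc by (simp add: algebra_simps power2_eq_square)
  finally show ?case .
qed (simp add: power2_eq_square)

text \<open>\<open>pair_gf M\<close> is the Gaussian binomial coefficient \<open>M + 2\<close> over \<open>2\<close> in \<open>q\<^sup>2\<close>.\<close>

lemma pair_gf_closed_form:
  "(1 - fps_X ^ 2) * (1 - fps_X ^ 4) * pair_gf M = (1 - fps_X ^ (2 * M + 2)) * (1 - fps_X ^ (2 * M + 4))"
proof (induction M)
  case 0
  then show ?case by (simp add: pair_gf_def power2_eq_square)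
next
  case (Suc M)
  define x y :: "int fps" where "x = fps_X" and "y = fps_X ^ (2 * M)"
  have pow: "fps_X ^ (2 * M + 2) = x\<^sup>2 * y" "fps_X ^ (2 * M + 4) = x ^ 4 * y"
    "fps_X ^ (2 * Suc M) = x\<^sup>2 * y" "fps_X ^ (2 * Suc M + 2) = x ^ 4 * y"
    "fps_X ^ (2 * Suc M + 4) = x ^ 6 * y"
    by (simp_all add: x_def y_def power_add eval_nat_numeral mult_ac)
  define S :: "int fps" where "S = (\<Sum>b\<le>Suc M. fps_X ^ (2 * b))"
  have S: "(1 - x ^ 2) * S = 1 - x ^ 4 * y"
    using sum_even_powers[of "Suc M"] by (simp only: S_def pow x_def)
  have IH: "(1 - x ^ 2) * (1 - x ^ 4) * pair_gf M = (1 - x\<^sup>2 * y) * (1 - x ^ 4 * y)"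
    using Suc by (simp only: pow x_def)
  have step: "pair_gf (Suc M) = pair_gf M + x\<^sup>2 * y * S"
    unfolding pow(3)[symmetric] S_def
    by (simp only: pair_gf_def sum.atMost_Suc power_add sum_distrib_left distrib_left)
  have "(1 - x ^ 2) * (1 - x ^ 4) * pair_gf (Suc M) =
      (1 - x ^ 2) * (1 - x ^ 4) * pair_gf M + x\<^sup>2 * y * (1 - x ^ 4) * ((1 - x ^ 2) * S)"
    unfolding step by algebra
  also have "\<dots> = (1 - x ^ 4 * y) * (1 - x ^ 6 * y)"
    unfolding IH S by algebra
  finally show ?case
    unfolding pow by (simp add: x_def)
qed

text \<open>The two closed forms differ by the factor (1 - q^(2M+4)) - (1 - q^(2M+1)) = q^(2M+1) (1
  - q^3). The factors 1 + q and 1 + q^2 of the product remove its sign, since (1 - q^3)(1 + q)(1 +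
  q^2) = (1 + q + q^2)(1 - q^4). Cancelling the denominators leaves only nonnegative
  factors.\<close>

lemma distinct_moment_le_pair_gf:
  "nonneg_fps (fps_X ^ 6 * pair_gf M * distinct_gf (2 * M + 2) - distinct_moment 2 (2 * M + 4))"
proof -
  define x v E S :: "int fps" where "x = fps_X" and "v = fps_X ^ (2 * M + 1)"
    and "E = (\<Prod>i=3..2 * M + 2. 1 + fps_X ^ i)" and "S = (\<Sum>b\<le>M. fps_X ^ (2 * b))"
  have pow: "fps_X ^ (2 * M + 2) = x * v" "fps_X ^ (2 * M + 4) = x ^ 3 * v"
    by (simp_all add: x_def v_def power_add eval_nat_numeral mult_ac)
  have "{1..2 * M + 2} = insert 1 (insert 2 {3..2 * M + 2})"
    by auto
  then have D: "distinct_gf (2 * M + 2) = (1 + x) * (1 + x\<^sup>2) * E"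
    by (simp add: distinct_gf_def E_def x_def mult_ac)
  have S: "(1 - x\<^sup>2) * S = 1 - x * v"
    using sum_even_powers[of M] by (simp only: S_def pow x_def)
  have Y: "(1 - x\<^sup>2) * (1 - x ^ 4) * pair_gf M = (1 - x * v) * (1 - x ^ 3 * v)"
    using pair_gf_closed_form[of M] by (simp only: pow x_def)
  have F: "(1 - x\<^sup>2) * (1 - x ^ 4) * distinct_moment 2 (2 * M + 4) =
      x ^ 6 * (1 - v) * (1 - x * v) * ((1 + x) * (1 + x\<^sup>2) * E)"
  proof -
    have "2 * M + 1 + 3 = 2 * M + 4" "Suc (2 * M + 1) = 2 * M + 2"
      by simp_all
    then show ?thesis
      using distinct_moment_2[of "2 * M + 1"] by (simp only: D pow v_def x_def)
  qed
  have "(1 - x\<^sup>2) * (1 - x ^ 4) *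
        (x ^ 6 * pair_gf M * ((1 + x) * (1 + x\<^sup>2) * E) - distinct_moment 2 (2 * M + 4)) =
      x ^ 6 * ((1 + x) * (1 + x\<^sup>2) * E) * ((1 - x\<^sup>2) * (1 - x ^ 4) * pair_gf M) -
      (1 - x\<^sup>2) * (1 - x ^ 4) * distinct_moment 2 (2 * M + 4)"
    by algebra
  also have "\<dots> = (1 - x ^ 4) * (x ^ 6 * v * (1 + x + x\<^sup>2) * E * ((1 - x\<^sup>2) * S))"
    unfolding Y F S by algebra
  also have "\<dots> = (1 - x\<^sup>2) * (1 - x ^ 4) * (x ^ 6 * v * (1 + x + x\<^sup>2) * E * S)"
    by algebra
  finally have eq: "(1 - x\<^sup>2) * (1 - x ^ 4) *
        (x ^ 6 * pair_gf M * ((1 + x) * (1 + x\<^sup>2) * E) - distinct_moment 2 (2 * M + 4)) =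
      (1 - x\<^sup>2) * (1 - x ^ 4) * (x ^ 6 * v * (1 + x + x\<^sup>2) * E * S)" .
  \<comment> \<open>A nonzero series can be cancelled, because integer power series have no zero
    divisors.\<close>
  have "fps_nth ((1 - x\<^sup>2) * (1 - x ^ 4)) 0 = 1"
    by (simp add: x_def)
  then have nonzero: "(1 - x\<^sup>2) * (1 - x ^ 4) \<noteq> 0"
    by (metis fps_zero_nth zero_neq_one)
  from eq have "x ^ 6 * pair_gf M * ((1 + x) * (1 + x\<^sup>2) * E) - distinct_moment 2 (2 * M + 4) =
      x ^ 6 * v * (1 + x + x\<^sup>2) * E * S"
    by (rule mult_left_cancel[OF nonzero, THEN iffD1])
  moreover have "nonneg_fps (x ^ 6 * v * (1 + x ^ 1 + x\<^sup>2) * E * S)"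
    unfolding x_def v_def E_def S_def by (intro nonneg_fps_intros)
  ultimately show ?thesis
    unfolding D by (simp add: x_def)
qed

subsection \<open>The second moment for odd parts\<close>

text \<open>A pair \<open>s < t\<close> of parts is sent to the two run starts \<open>s\<close> and \<open>t\<close>, a pair \<open>s = t\<close> to the
  run start \<open>s\<close> and the repeated part \<open>s\<close>.\<close>

lemma card_pairs_le_choose_two:
  assumes "\<forall>x\<in>#P. odd x"
  shows "card {(a, b) \<in> (SIGMA a:{..M}. {..a}). {#2 * a + 3, 2 * b + 3#} \<subseteq># P}
    \<le> (card (run_starts (set_mset P)) + card (repeated P)) choose 2"
proof -
  let ?I = "{(a, b) \<in> (SIGMA a:{..M}. {..a}). {#2 * a + 3, 2 * b + 3#} \<subseteq># P}"
  \<comment> \<open>The sum is disjoint because one size may yield both a run start and a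
    repetition, which are two different hooks.\<close>
  let ?Z = "run_starts (set_mset P) <+> repeated P"
  define f :: "nat \<times> nat \<Rightarrow> (nat + nat) set" where
    "f = (\<lambda>(a, b). {Inl (2 * a + 3), if a = b then Inr (2 * a + 3) else Inl (2 * b + 3)})"
  \<comment> \<open>All parts are odd, so the even number below a part of size at least 3 is never a
    part.\<close>
  have start: "2 * a + 3 \<in> run_starts (set_mset P)" if "2 * a + 3 \<in># P" for a
  proof -
    have "even (2 * a + 3 - 1)" by simp
    then have "2 * a + 3 - 1 \<notin># P"
      using assms by blast
    with that show ?thesis by (simp add: run_starts_def)
  qed
  have finZ: "finite ?Z"
    by (simp add: finite_run_starts finite_repeated)
  \<comment> \<open>The condition \<open>b \<le> a\<close> recovers the order of the pair from the
    unordered set.\<close>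
  have "inj_on f ?I"
    by (rule inj_onI) (auto simp: f_def doubleton_eq_iff split: if_splits)
  moreover have "f ` ?I \<subseteq> {B. B \<subseteq> ?Z \<and> card B = 2}"
  proof (rule image_subsetI)
    fix c assume "c \<in> ?I"
    then obtain a b where c: "c = (a, b)" and sub: "{#2 * a + 3, 2 * b + 3#} \<subseteq># P"
      by auto
    then have mem: "2 * a + 3 \<in># P" "2 * b + 3 \<in># P"
      by (auto dest: mset_subset_eqD)
    moreover have "2 * a + 3 \<in> repeated P" if "a = b"
      using mset_subset_eq_count[OF sub, of "2 * a + 3"] that by (simp add: repeated_def)
    ultimately have "f c \<subseteq> ?Z"
      using start by (auto simp: f_def c)
    moreover have "card (f c) = 2"
      by (auto simp: f_def c)
    ultimately show "f c \<in> {B. B \<subseteq> ?Z \<and> card B = 2}"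
      by simp
  qed
  moreover have "finite {B. B \<subseteq> ?Z \<and> card B = 2}"
    by (rule finite_subset[of _ "Pow ?Z"]) (use finZ in auto)
  ultimately have "card ?I \<le> card {B. B \<subseteq> ?Z \<and> card B = 2}"
    by (rule card_inj_on_le)
  also have "\<dots> = card ?Z choose 2"
    using finZ by (rule n_subsets)
  also have "card ?Z = card (run_starts (set_mset P)) + card (repeated P)"
    by (simp add: card_Plus finite_run_starts finite_repeated)
  finally show ?thesis .
qed

text \<open>The coefficient counts partitions with a marked pair of contained parts; summing over
  the partition first bounds it by pairs of hooks.\<close>

lemma pair_gf_partition_gf_le:
  "fps_nth (fps_X ^ 6 * pair_gf M * partition_gf (odd_parts (M + 2))) n \<le>
     int (\<Sum>P\<in>multiset_partitions (odd_parts (M + 2)) n.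
       (card (run_starts (set_mset P)) + card (repeated P)) choose 2)"
proof -
  let ?T = "odd_parts (M + 2)" and ?I = "SIGMA a:{..M}. {..a}"
  let ?A = "\<lambda>(a, b). {#2 * a + 3, 2 * b + 3#}"
  let ?P = "multiset_partitions ?T n"
  have fin: "finite ?P"
    by (rule finite_multiset_partitions) simp
  have "fps_X ^ 6 * pair_gf M = (\<Sum>a\<le>M. \<Sum>b\<le>a. fps_X ^ (6 + (2 * a + 2 * b)))"
    by (simp only: pair_gf_def sum_distrib_left power_add)
  \<comment> \<open>The factor q^6 supplies the two summands 3 of \<open>2 * a + 3\<close> and
    \<open>2 * b + 3\<close>.\<close>
  also have "\<dots> = (\<Sum>c\<in>?I. fps_X ^ \<Sum>\<^sub># (?A c))"
    by (subst sum.Sigma) (auto intro!: sum.cong arg_cong[of _ _ "\<lambda>k. fps_X ^ k"])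
  finally have "fps_X ^ 6 * pair_gf M * partition_gf ?T = (\<Sum>c\<in>?I. fps_X ^ \<Sum>\<^sub># (?A c) * partition_gf ?T)"
    by (simp only: sum_distrib_right)
  then have "fps_nth (fps_X ^ 6 * pair_gf M * partition_gf ?T) n =
      (\<Sum>c\<in>?I. fps_nth (fps_X ^ \<Sum>\<^sub># (?A c) * partition_gf ?T) n)"
    by (simp only: fps_sum_nth)
  \<comment> \<open>As \<open>2 * (M + 2) - 1 = 2 * M + 3\<close>, the bound
    \<open>a \<le> M\<close> keeps both sizes in \<open>?T\<close>.\<close>
  also have "\<dots> = (\<Sum>c\<in>?I. int (card {P \<in> ?P. ?A c \<subseteq># P}))"
    by (intro sum.cong refl fps_nth_X_power_mult_partition_gf) auto
  also have "\<dots> = int (\<Sum>c\<in>?I. card {P \<in> ?P. ?A c \<subseteq># P})"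
    by simp
  also have "(\<Sum>c\<in>?I. card {P \<in> ?P. ?A c \<subseteq># P}) = (\<Sum>P\<in>?P. card {c \<in> ?I. ?A c \<subseteq># P})"
    using sum.swap_restrict[of ?I ?P "\<lambda>_ _. 1::nat" "\<lambda>c P. ?A c \<subseteq># P"] fin by simp
  finally have "fps_nth (fps_X ^ 6 * pair_gf M * partition_gf ?T) n =
      int (\<Sum>P\<in>?P. card {c \<in> ?I. ?A c \<subseteq># P})" .
  moreover have "(\<Sum>P\<in>?P. card {c \<in> ?I. ?A c \<subseteq># P}) \<le>
      (\<Sum>P\<in>?P. (card (run_starts (set_mset P)) + card (repeated P)) choose 2)"
  proof (rule sum_mono)
    fix P assume "P \<in> ?P"
    then have "\<forall>x\<in>#P. odd x"
      by (auto simp: multiset_partitions_def)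
    then have "card {(a, b) \<in> ?I. {#2 * a + 3, 2 * b + 3#} \<subseteq># P}
        \<le> (card (run_starts (set_mset P)) + card (repeated P)) choose 2"
      by (rule card_pairs_le_choose_two)
    also have "{(a, b) \<in> ?I. {#2 * a + 3, 2 * b + 3#} \<subseteq># P} = {c \<in> ?I. ?A c \<subseteq># P}"
      by auto
    finally show "card {c \<in> ?I. ?A c \<subseteq># P}
        \<le> (card (run_starts (set_mset P)) + card (repeated P)) choose 2" .
  qed
  ultimately show ?thesis
    by (simp only: of_nat_le_iff)
qed

section \<open>Coefficients of the moments and the final chain of inequalities\<close>

lemma fps_nth_distinct_moment:
  "fps_nth (distinct_moment k N) n =
     int (\<Sum>S\<in>{S. S \<subseteq> {1..N} \<and> \<Sum>S = n}. card (run_starts S) choose k)"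
proof -
  have "fps_nth (distinct_moment k N) n =
      (\<Sum>S\<in>Pow {1..N}. if \<Sum>S = n then int (card (run_starts S) choose k) else 0)"
    by (auto simp: distinct_moment_def fps_sum_nth fps_X_power_nth simp flip: fps_of_nat intro!: sum.cong)
  also have "\<dots> = (\<Sum>S\<in>{S \<in> Pow {1..N}. \<Sum>S = n}. int (card (run_starts S) choose k))"
    by (rule sum.inter_filter[symmetric]) simp
  finally show ?thesis
    by (simp add: Pow_def)
qed

theorem theorem1p5:
  fixes L n :: nat
  assumes "L \<ge> 1"
  shows "(\<Sum>m. (m choose 2) * a2 L m n) \<ge> (\<Sum>m. (m choose 2) * b2 (2 * L) m n)"
proof (cases "L = 1")
  case True
  \<comment> \<open>Distinct parts at most 2 have at most one run start, so the smaller side is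
    0.\<close>
  have "distinct_moment 2 2 = 0"
    using distinct_moment_Suc_Suc[of 1 0] distinct_moment_Suc_small
    by (simp add: numeral_2_eq_2)
  moreover have "int (\<Sum>m. (m choose 2) * b2 (2 * L) m n) = fps_nth (distinct_moment 2 2) n"
    by (simp only: suminf_b2 fps_nth_distinct_moment True mult_1_right)
  ultimately show ?thesis
    by simp
next
  case False
  define M where "M = L - 2"
  have L: "L = M + 2" "2 * L = 2 * M + 4"
    using assms False by (simp_all add: M_def)
  have "int (\<Sum>m. (m choose 2) * b2 (2 * L) m n) = fps_nth (distinct_moment 2 (2 * M + 4)) n"
    by (simp only: suminf_b2 fps_nth_distinct_moment L(2))
  also have "\<dots> \<le> fps_nth (fps_X ^ 6 * pair_gf M * distinct_gf (2 * M + 2)) n"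
    using distinct_moment_le_pair_gf[of M] by (simp add: nonneg_fps_def)
  also have "\<dots> \<le> fps_nth (fps_X ^ 6 * pair_gf M * partition_gf (odd_parts (M + 2))) n"
  proof -
    \<comment> \<open>The odd numbers up to \<open>2 * M + 2\<close> all lie below the bound
      \<open>2 * M + 3\<close>, so Glaisher's comparison applies.\<close>
    have "nonneg_fps (partition_gf (odd_parts (M + 2)) - distinct_gf (2 * M + 2))"
      by (rule distinct_gf_le_partition_gf) auto
    then have "nonneg_fps (fps_X ^ 6 * pair_gf M *
        (partition_gf (odd_parts (M + 2)) - distinct_gf (2 * M + 2)))"
      unfolding pair_gf_def by (intro nonneg_fps_intros)
    then show ?thesis
      by (simp add: nonneg_fps_def right_diff_distrib)
  qed
  also have "\<dots> \<le> int (\<Sum>m. (m choose 2) * a2 L m n)"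
    using pair_gf_partition_gf_le by (simp only: suminf_a2 L)
  finally show ?thesis by simp
qed

end
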